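(* Let $Y$ be a Banach space and $N\in\mathbb{N}$. Then $(\ell_1^N,Y;\mathbb{K})$ has property $\mathbf{L}_{p,p}$ (for bilinear forms) if and only if the norm of $Y$ is strongly subdifferentiable.
   Context: Banach spaces are over $\mathbb{K}=\mathbb{R}$ or $\mathbb{C}$. $\ell_1^N$ is $\mathbb{K}^N$ with the norm $\|x\|_1=\sum_{j=1}^N|x_j|$. $S_X$ and $B_X$ denote the unit sphere and closed unit ball of $X$. $\mathcal{L}(X_1,X_2;\mathbb{K})$ is the space of bounded bilinear forms on $X_1\times X_2$ with $\|A\|=\sup\{|A(x_1,x_2)|: x_i\in S_{X_i}\}$. $(X_1,X_2;\mathbb{K})$ has property $\mathbf{L}_{p,p}$ if for every $\varepsilon>0$ and every $(x_1,x_2)\in S_{X_1}\times S_{X_2}$ there is $\eta=\eta(\varepsilon,(x_1,x_2))>0$ such that whenever $A\in\mathcal{L}(X_1,X_2;\mathbb{K})$ satisfies $\|A\|=1$ and $|A(x_1,x_2)|>1-\eta$, there is $B\in\mathcal{L}(X_1,X_2;\mathbb{K})$ with $\|B\|=1$, $|B(x_1,x_2)|=1$ and $\|B-A\|<\varepsilon$. The norm of $Y$ is strongly subdifferentiable (SSD) if for every $y\in S_Y$ the one-sided limit $\lim_{t\to0^+}\frac{\|y+th\|-\|y\|}{t}$ exists uniformly for $h\in B_Y$. *)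

theory Defs
  imports "HOL-Analysis.Analysis"
begin

text \<open>
  The library has no complex normed spaces.  A normed space over a scalar field (below always
  \<open>real\<close> or \<open>complex\<close>) is a type of class \<^class>\<open>real_normed_vector\<close> together with a
  scalar multiplication that extends \<^const>\<open>scaleR\<close> and for which the norm is homogeneous.
  For real scalars the only such multiplication is \<^const>\<open>scaleR\<close> itself.
\<close>

locale normed_space_over = vector_space scale
  for scale :: "'k::real_normed_field \<Rightarrow> 'v::real_normed_vector \<Rightarrow> 'v" +
  assumes scale_of_real: "scale (of_real r) v = r *\<^sub>R v"
    and norm_scale: "norm (scale c v) = norm c * norm v"

lemma normed_space_over_scaleR:
  "normed_space_over (scaleR :: real \<Rightarrow> 'v::real_normed_vector \<Rightarrow> 'v)"
  by unfold_locales (auto simp: algebra_simps)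

text \<open>
  The space \<open>\<ell>\<^sub>1\<^sup>N\<close> over the scalars \<open>'k\<close>, where \<open>N\<close> is the cardinality (at least 1) of \<open>'n\<close>.
  It needs a type of its own because \<^typ>\<open>'k ^ 'n\<close> carries the Euclidean norm.
\<close>

typedef ('k, 'n) ell1 = "UNIV :: ('k ^ 'n::finite) set"
  morphisms coords of_coords ..

setup_lifting type_definition_ell1

instantiation ell1 :: (real_normed_field, finite) real_normed_vector
begin

lift_definition zero_ell1 :: "('a, 'b) ell1" is 0 .
lift_definition plus_ell1 :: "('a, 'b) ell1 \<Rightarrow> ('a, 'b) ell1 \<Rightarrow> ('a, 'b) ell1" is "(+)" .
lift_definition minus_ell1 :: "('a, 'b) ell1 \<Rightarrow> ('a, 'b) ell1 \<Rightarrow> ('a, 'b) ell1" is "(-)" .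
lift_definition uminus_ell1 :: "('a, 'b) ell1 \<Rightarrow> ('a, 'b) ell1" is uminus .
lift_definition scaleR_ell1 :: "real \<Rightarrow> ('a, 'b) ell1 \<Rightarrow> ('a, 'b) ell1" is scaleR .
lift_definition norm_ell1 :: "('a, 'b) ell1 \<Rightarrow> real" is "\<lambda>x. \<Sum>j\<in>UNIV. norm (x $ j)" .

definition dist_ell1 :: "('a, 'b) ell1 \<Rightarrow> ('a, 'b) ell1 \<Rightarrow> real"
  where "dist_ell1 x y = norm (x - y)"
definition sgn_ell1 :: "('a, 'b) ell1 \<Rightarrow> ('a, 'b) ell1"
  where "sgn_ell1 x = scaleR (inverse (norm x)) x"
definition uniformity_ell1 :: "(('a, 'b) ell1 \<times> ('a, 'b) ell1) filter"
  where "uniformity_ell1 = (INF e\<in>{0<..}. principal {(x, y). dist x y < e})"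
definition open_ell1 :: "('a, 'b) ell1 set \<Rightarrow> bool"
  where "open_ell1 U \<longleftrightarrow> (\<forall>x\<in>U. eventually (\<lambda>(x', y). x' = x \<longrightarrow> y \<in> U) uniformity)"

instance
proof
  fix x y :: "('a, 'b) ell1" and a :: real
  show "norm x = 0 \<longleftrightarrow> x = 0"
    by transfer (simp add: sum_nonneg_eq_0_iff vec_eq_iff)
  show "norm (x + y) \<le> norm x + norm y"
    by transfer (simp add: norm_triangle_ineq sum_mono flip: sum.distrib)
  show "norm (a *\<^sub>R x) = \<bar>a\<bar> * norm x"
    by transfer (simp add: sum_distrib_left)
qed (fact dist_ell1_def sgn_ell1_def uniformity_ell1_def open_ell1_def
      | transfer, simp add: algebra_simps)+

end

lift_definition scale_ell1 :: "'k::real_normed_field \<Rightarrow> ('k, 'n::finite) ell1 \<Rightarrow> ('k, 'n) ell1"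
  is "(*s)" .

lemma normed_space_over_scale_ell1:
  "normed_space_over (scale_ell1 :: 'k::real_normed_field \<Rightarrow> ('k, 'n::finite) ell1 \<Rightarrow> _)"
proof
  fix a b r c and x y :: "('k, 'n) ell1"
  show "scale_ell1 a (x + y) = scale_ell1 a x + scale_ell1 a y"
    by transfer (simp add: vec_eq_iff algebra_simps)
  show "scale_ell1 (a + b) x = scale_ell1 a x + scale_ell1 b x"
    by transfer (simp add: vec_eq_iff algebra_simps)
  show "scale_ell1 a (scale_ell1 b x) = scale_ell1 (a * b) x"
    by transfer (simp add: vec_eq_iff algebra_simps)
  show "scale_ell1 1 x = x"
    by transfer simp
  show "scale_ell1 (of_real r) x = r *\<^sub>R x"
    by transfer (simp add: vec_eq_iff scaleR_conv_of_real[where 'a = 'k])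
  show "norm (scale_ell1 c x) = norm c * norm x"
    by transfer (simp add: norm_mult sum_distrib_left)
qed

text \<open>
  \<^const>\<open>bounded_bilinear\<close> only refers to real scalars; homogeneity over \<open>'k\<close> is added.
\<close>

definition bounded_bilinear_form ::
  "('k::real_normed_field \<Rightarrow> 'x::real_normed_vector \<Rightarrow> 'x) \<Rightarrow>
   ('k \<Rightarrow> 'y::real_normed_vector \<Rightarrow> 'y) \<Rightarrow> ('x \<Rightarrow> 'y \<Rightarrow> 'k) \<Rightarrow> bool"
  where "bounded_bilinear_form s1 s2 A \<longleftrightarrow>
    bounded_bilinear A \<and>
    (\<forall>c x y. A (s1 c x) y = c * A x y) \<and> (\<forall>c x y. A x (s2 c y) = c * A x y)"

text \<open>
  Only meaningful if both unit spheres are nonempty; below it is never used otherwise.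
\<close>

definition form_norm ::
  "('x::real_normed_vector \<Rightarrow> 'y::real_normed_vector \<Rightarrow> 'k::real_normed_field) \<Rightarrow> real"
  where "form_norm A = (SUP (x, y)\<in>sphere 0 1 \<times> sphere 0 1. norm (A x y))"

definition property_Lpp ::
  "('k::real_normed_field \<Rightarrow> 'x::real_normed_vector \<Rightarrow> 'x) \<Rightarrow>
   ('k \<Rightarrow> 'y::real_normed_vector \<Rightarrow> 'y) \<Rightarrow> bool"
  where "property_Lpp s1 s2 \<longleftrightarrow>
    (\<forall>\<epsilon>>0. \<forall>x1\<in>sphere 0 1. \<forall>x2\<in>sphere 0 1. \<exists>\<eta>>0. \<forall>A.
      bounded_bilinear_form s1 s2 A \<and> form_norm A = 1 \<and> norm (A x1 x2) > 1 - \<eta> \<longrightarrow>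
      (\<exists>B. bounded_bilinear_form s1 s2 B \<and> form_norm B = 1 \<and> norm (B x1 x2) = 1 \<and>
        form_norm (\<lambda>x y. B x y - A x y) < \<epsilon>))"

definition SSD_norm :: "'y::real_normed_vector itself \<Rightarrow> bool"
  where "SSD_norm _ \<longleftrightarrow>
    (\<forall>y\<in>sphere (0::'y) 1. \<exists>L. uniform_limit (cball 0 1)
      (\<lambda>t h. (norm (y + t *\<^sub>R h) - norm y) / t) L (at_right 0))"

end

theory Submission imports Defs begin

text \<open>
  A bilinear form on \<open>\<ell>\<^sub>1\<^sup>N \<times> Y\<close> is a tuple of \<open>N\<close> functionals on \<open>Y\<close>, normed by the maximum, so
  the property reduces to functionals: those almost norming \<open>y\<close> must be close to
  functionals of norm one attaining their norm at \<open>y\<close>.  The directional derivative \<open>L\<close> of the norm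
  at \<open>y\<close> is sublinear, and the functionals dominated by \<open>L\<close> are exactly the norm-one functionals
  with value one at \<open>y\<close>.
  If the difference quotients converge uniformly to \<open>L\<close>, then an almost norming \<open>f\<close>
  satisfies \<open>f \<le> L + \<delta> \<parallel>\<cdot>\<parallel>\<close> and the sandwich form of the Hahn--Banach theorem yields \<open>g \<le> L\<close> with
  \<open>\<parallel>f - g\<parallel> \<le> \<delta>\<close>.  Conversely, functionals norming \<open>y + t h\<close> almost norm \<open>y\<close>, and replacing them by
  nearby functionals below \<open>L\<close> bounds the difference quotient uniformly in \<open>h\<close>.
\<close>

section \<open>Sublinear functionals and the Hahn--Banach theorem\<close>

text \<open>Positive homogeneity is demanded as an inequality only, which is easier to check for
  infima; applying it to the inverse factor gives equality.\<close>

definition sublinear :: "('a::real_vector \<Rightarrow> real) \<Rightarrow> bool"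
  where "sublinear p \<longleftrightarrow>
    (\<forall>x y. p (x + y) \<le> p x + p y) \<and> (\<forall>r>0. \<forall>x. p (r *\<^sub>R x) \<le> r * p x)"

lemma sublinear_add: "sublinear p \<Longrightarrow> p (x + y) \<le> p x + p y"
  by (simp add: sublinear_def)

lemma sublinear_scaleR:
  assumes "sublinear p" "r > 0"
  shows "p (r *\<^sub>R x) = r * p x"
proof (rule antisym)
  show "p (r *\<^sub>R x) \<le> r * p x"
    using assms by (simp add: sublinear_def)
  have "p (inverse r *\<^sub>R (r *\<^sub>R x)) \<le> inverse r * p (r *\<^sub>R x)"
    using assms unfolding sublinear_def by (metis positive_imp_inverse_positive)
  then show "r * p x \<le> p (r *\<^sub>R x)"
    using assms(2) by (simp add: field_simps)
qed

lemma sublinear_zero: "sublinear p \<Longrightarrow> p 0 = 0"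
  using sublinear_scaleR[of p 2 0] by simp

lemma sublinear_uminus: "sublinear p \<Longrightarrow> - p (- x) \<le> p x"
  using sublinear_add[of p x "- x"] sublinear_zero[of p] by simp

text \<open>Common tool for infima over chains, infimal convolutions, shifts along a direction and
  difference quotients. The estimates for sums and multiples may pass to a new index
  \<open>k\<close>, so the single members \<open>F i\<close> need not be sublinear.\<close>

lemma sublinear_INF:
  assumes "I \<noteq> {}"
    and bdd: "\<And>x. bdd_below ((\<lambda>i. F i x) ` I)"
    and add: "\<And>i j x y. i \<in> I \<Longrightarrow> j \<in> I \<Longrightarrow> \<exists>k\<in>I. F k (x + y) \<le> F i x + F j y"
    and scale: "\<And>i r x. i \<in> I \<Longrightarrow> r > 0 \<Longrightarrow> \<exists>k\<in>I. F k (r *\<^sub>R x) \<le> r * F i x"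
  shows "sublinear (\<lambda>x. INF i\<in>I. F i x :: real)"
  unfolding sublinear_def
proof (intro conjI allI impI)
  fix x y
  have *: "(INF i\<in>I. F i (x + y)) \<le> F i x + F j y" if "i \<in> I" "j \<in> I" for i j
    using add[OF that, of x y] cINF_lower[OF bdd] by (meson order_trans)
  have "(INF i\<in>I. F i (x + y)) - F j y \<le> (INF i\<in>I. F i x)" if "j \<in> I" for j
    using *[OF _ that] by (intro cINF_greatest assms(1)) (simp add: algebra_simps)
  then have "(INF i\<in>I. F i (x + y)) - (INF i\<in>I. F i x) \<le> (INF i\<in>I. F i y)"
    by (intro cINF_greatest assms(1)) (simp add: algebra_simps)
  then show "(INF i\<in>I. F i (x + y)) \<le> (INF i\<in>I. F i x) + (INF i\<in>I. F i y)"
    by simp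
next
  fix r :: real and x
  assume r: "r > 0"
  have "(INF i\<in>I. F i (r *\<^sub>R x)) \<le> r * F i x" if "i \<in> I" for i
    using scale[OF that r, of x] cINF_lower[OF bdd] by (meson order_trans)
  then have "(INF i\<in>I. F i (r *\<^sub>R x)) / r \<le> (INF i\<in>I. F i x)"
    using r by (intro cINF_greatest assms(1)) (simp add: field_simps)
  then show "(INF i\<in>I. F i (r *\<^sub>R x)) \<le> r * (INF i\<in>I. F i x)"
    using r by (simp add: field_simps)
qed

text \<open>Shifting along \<open>a\<close> gives the sublinear minorant
  \<open>INF t\<in>{0..}. q (x + t *\<^sub>R a) - t * q a\<close> of \<open>q\<close>. By minimality
  it equals \<open>q\<close>, and the shift \<open>t = 1\<close> at \<open>- a\<close> shows
  \<open>q (- a) \<le> - q a\<close>. Hence \<open>q\<close> is odd, and an odd sublinear functional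
  is linear.\<close>

lemma minimal_sublinear_linear:
  assumes q: "sublinear q"
    and min: "\<And>p. sublinear p \<Longrightarrow> (\<And>x. p x \<le> q x) \<Longrightarrow> p = q"
  shows "linear q"
proof -
  have neg: "q (- a) = - q a" for a
  proof -
    define F where "F t x = q (x + t *\<^sub>R a) - t * q a" for t x
    have q_mult: "q (t *\<^sub>R a) = t * q a" if "t \<ge> 0" for t
      using that sublinear_scaleR[OF q, of t a] sublinear_zero[OF q] by (cases "t = 0") auto
    have lower: "- q (- x) \<le> F t x" if "t \<ge> 0" for t x
      using q_mult[OF that] sublinear_add[OF q, of "x + t *\<^sub>R a" "- x"] by (simp add: F_def)
    have bdd: "bdd_below ((\<lambda>t. F t x) ` {0..})" for x
      using lower by (intro bdd_belowI2[where m = "- q (- x)"]) auto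
    have "sublinear (\<lambda>x. INF t\<in>{0..}. F t x)"
    proof (rule sublinear_INF[OF _ bdd])
      fix s t :: real and x y
      assume "s \<in> {0..}" "t \<in> {0..}"
      moreover have "F (s + t) (x + y) \<le> F s x + F t y"
        using sublinear_add[OF q, of "x + s *\<^sub>R a" "y + t *\<^sub>R a"]
        by (simp add: F_def algebra_simps)
      ultimately show "\<exists>k\<in>{0..}. F k (x + y) \<le> F s x + F t y"
        by (intro bexI[of _ "s + t"]) auto
    next
      fix t r :: real and x
      assume "t \<in> {0..}" and r: "r > 0"
      moreover have "F (r * t) (r *\<^sub>R x) \<le> r * F t x"
        using sublinear_scaleR[OF q r, of "x + t *\<^sub>R a"] by (simp add: F_def algebra_simps)
      ultimately show "\<exists>k\<in>{0..}. F k (r *\<^sub>R x) \<le> r * F t x"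
        by (intro bexI[of _ "r * t"]) auto
    qed auto
    moreover have "(INF t\<in>{0..}. F t x) \<le> q x" for x
      using cINF_lower[OF bdd, of 0 x] by (simp add: F_def)
    ultimately have "(\<lambda>x. INF t\<in>{0..}. F t x) = q"
      by (rule min)
    then have "q (- a) = (INF t\<in>{0..}. F t (- a))"
      by metis
    also have "\<dots> \<le> F 1 (- a)"
      by (rule cINF_lower[OF bdd]) simp
    also have "\<dots> = - q a"
      using sublinear_zero[OF q] by (simp add: F_def)
    finally show ?thesis
      using sublinear_uminus[OF q, of a] by simp
  qed
  show ?thesis
  proof (rule linearI)
    fix x y
    show "q (x + y) = q x + q y"
      using sublinear_add[OF q, of x y] sublinear_add[OF q, of "x + y" "- y"] neg by simp
  next
    fix r :: real and x
    consider "r > 0" | "r = 0" | "- r > 0" by linarith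
    then show "q (r *\<^sub>R x) = r *\<^sub>R q x"
    proof cases
      case 3
      then have "q ((- r) *\<^sub>R x) = - r * q x"
        by (rule sublinear_scaleR[OF q])
      then show ?thesis using neg[of "r *\<^sub>R x"] by simp
    qed (use sublinear_scaleR[OF q] sublinear_zero[OF q] in auto)
  qed
qed

text \<open>Zorn's lemma yields a minimal element among the sublinear functionals below
  \<open>p\<close>, and minimal ones are linear.\<close>

lemma Hahn_Banach_sublinear:
  fixes p :: "'a::real_vector \<Rightarrow> real"
  assumes p: "sublinear p"
  obtains g where "linear g" "\<And>x. g x \<le> p x"
proof -
  define S where "S = {q. sublinear q \<and> (\<forall>x. q x \<le> p x)}"
  \<comment> \<open>The order is reversed, so that a maximal element for \<open>r\<close> is
    pointwise minimal.\<close>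
  define r where "r = {(q, q'). q \<in> S \<and> q' \<in> S \<and> (\<forall>x. q' x \<le> (q x :: real))}"
  have field: "Field r = S"
    by (auto simp: Field_def r_def)
  have "Partial_order r"
    unfolding partial_order_on_def preorder_on_def
  proof (intro conjI)
    show "refl_on (Field r) r"
      unfolding field by (auto simp: refl_on_def r_def)
    show "trans r"
      unfolding trans_def r_def using order_trans by blast
    show "antisym r"
      by (intro antisymI) (auto simp: r_def intro!: ext antisym)
  qed (auto simp: r_def Field_def)
  moreover have "\<exists>u\<in>Field r. \<forall>q\<in>C. (q, u) \<in> r" if C: "C \<in> Chains r" for C
  proof (cases "C = {}")
    case True
    then show ?thesis using p by (auto simp: field S_def)
  next
    case False
    have CS: "C \<subseteq> S"
      using C by (auto simp: Chains_def r_def)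
    have total: "(\<forall>x. q' x \<le> q x) \<or> (\<forall>x. q x \<le> q' x)" if "q \<in> C" "q' \<in> C" for q q'
      using C that by (auto simp: Chains_def r_def)
    \<comment> \<open>All sublinear minorants of \<open>p\<close> share the lower bound
      \<open>- p (- x)\<close>, so the pointwise infimum of the chain is finite.\<close>
    have bdd: "bdd_below ((\<lambda>q. q x) ` C)" for x
    proof (rule bdd_belowI2[where m = "- p (- x)"])
      fix q assume "q \<in> C"
      then have "sublinear q" "q (- x) \<le> p (- x)"
        using CS by (auto simp: S_def)
      then show "- p (- x) \<le> q x"
        using sublinear_uminus[of q x] by simp
    qed
    define u where "u x = (INF q\<in>C. q x)" for x
    have "sublinear u"
      unfolding u_def
    proof (rule sublinear_INF[OF False bdd])
      fix q q' x y
      assume qs: "q \<in> C" "q' \<in> C"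
      then have "sublinear q" "sublinear q'"
        using CS by (auto simp: S_def)
      \<comment> \<open>The smaller of the two comparable members bounds both terms and serves as
        \<open>k\<close>.\<close>
      with total[OF qs] qs show "\<exists>k\<in>C. k (x + y) \<le> q x + q' y"
        by (smt (verit) sublinear_add)
    next
      fix q r x
      assume "q \<in> C" "(r :: real) > 0"
      moreover then have "sublinear q"
        using CS by (auto simp: S_def)
      ultimately show "\<exists>k\<in>C. k (r *\<^sub>R x) \<le> r * q x"
        using sublinear_scaleR[of q r x] by (intro bexI[of _ q]) auto
    qed
    moreover have le: "u x \<le> q x" if "q \<in> C" for q x
      unfolding u_def by (rule cINF_lower[OF bdd that])
    moreover obtain q0 where "q0 \<in> C" "\<And>x. q0 x \<le> p x"
      using False CS by (auto simp: S_def)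
    ultimately have "u \<in> S"
      unfolding S_def using order_trans by blast
    moreover from this have "\<forall>q\<in>C. (q, u) \<in> r"
      using CS le by (auto simp: r_def)
    ultimately show ?thesis
      unfolding field by blast
  qed
  ultimately obtain q where q: "q \<in> S" and max: "\<And>q'. q' \<in> S \<Longrightarrow> (q, q') \<in> r \<Longrightarrow> q' = q"
    using Zorns_po_lemma[of r] unfolding field by blast
  have "linear q"
  proof (rule minimal_sublinear_linear)
    fix q' assume "sublinear q'" "\<And>x. q' x \<le> q x"
    moreover then have "q' \<in> S"
      using q unfolding S_def by (auto intro: order_trans)
    ultimately show "q' = q"
      using q by (intro max) (auto simp: r_def)
  qed (use q in \<open>simp add: S_def\<close>)
  with q that show thesis by (auto simp: S_def)
qed

text \<open>A linear functional below the infimal convolution of \<open>p\<close> and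
  \<open>q\<close> lies below both: split \<open>x\<close> as \<open>x + 0\<close> and as
  \<open>0 + x\<close>. The hypothesis \<open>pq\<close> is what keeps the infimal convolution
  finite.\<close>

lemma Hahn_Banach_sandwich:
  fixes p q :: "'a::real_vector \<Rightarrow> real"
  assumes p: "sublinear p" and q: "sublinear q" and pq: "\<And>x. 0 \<le> p x + q (- x)"
  obtains g where "linear g" "\<And>x. g x \<le> p x" "\<And>x. g x \<le> q x"
proof -
  have lower: "- q (- x) \<le> p k + q (x - k)" for x k
    using pq[of k] sublinear_add[OF q, of "x - k" "- x"] by simp
  have bdd: "bdd_below (range (\<lambda>k. p k + q (x - k)))" for x
    using lower by (intro bdd_belowI2[where m = "- q (- x)"])
  have "sublinear (\<lambda>x. INF k. p k + q (x - k))"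
  proof (rule sublinear_INF[OF _ bdd])
    fix i j x y
    show "\<exists>k\<in>UNIV. p k + q (x + y - k) \<le> p i + q (x - i) + (p j + q (y - j))"
      using sublinear_add[OF p, of i j] sublinear_add[OF q, of "x - i" "y - j"]
      by (intro bexI[of _ "i + j"]) (auto simp: algebra_simps)
  next
    fix i x and r :: real
    assume "r > 0"
    then show "\<exists>k\<in>UNIV. p k + q (r *\<^sub>R x - k) \<le> r * (p i + q (x - i))"
      using sublinear_scaleR[OF p, of r i] sublinear_scaleR[OF q, of r "x - i"]
      by (intro bexI[of _ "r *\<^sub>R i"]) (auto simp: algebra_simps)
  qed simp
  then obtain g where g: "linear g" "\<And>x. g x \<le> (INF k. p k + q (x - k))"
    using Hahn_Banach_sublinear by blast
  have *: "g x \<le> p k + q (x - k)" for x k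
    using g(2)[of x] cINF_lower[OF bdd, of k x] by simp
  show thesis
  proof
    show "g x \<le> p x" for x
      using *[of x x] sublinear_zero[OF q] by simp
    show "g x \<le> q x" for x
      using *[of x 0] sublinear_zero[OF p] by simp
  qed (fact g)
qed

text \<open>The auxiliary \<open>q\<close> is at most the norm (take \<open>t = 0\<close>) and at
  most \<open>- norm y\<close> at \<open>- y\<close> (take \<open>t = 1\<close>). A linear
  functional below \<open>q\<close> is therefore forced to take the value \<open>norm y\<close> at
  \<open>y\<close>.\<close>

lemma norming_functional:
  fixes y :: "'a::real_normed_vector"
  obtains g where "linear g" "\<And>x. g x \<le> norm x" "g y = norm y"
proof -
  define q where "q x = (INF t. norm (x + t *\<^sub>R y) - t * norm y)" for x
  have lower: "- norm x \<le> norm (x + t *\<^sub>R y) - t * norm y" for x t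
    using norm_triangle_ineq4[of "x + t *\<^sub>R y" x] abs_ge_self[of t]
      mult_right_mono[of t "\<bar>t\<bar>" "norm y"] by simp
  have bdd: "bdd_below (range (\<lambda>t. norm (x + t *\<^sub>R y) - t * norm y))" for x
    using lower by (intro bdd_belowI2[where m = "- norm x"])
  have "sublinear q"
    unfolding q_def
  proof (rule sublinear_INF[OF _ bdd])
    fix s t :: real and u v
    show "\<exists>k\<in>UNIV. norm (u + v + k *\<^sub>R y) - k * norm y
        \<le> norm (u + s *\<^sub>R y) - s * norm y + (norm (v + t *\<^sub>R y) - t * norm y)"
      using norm_triangle_ineq[of "u + s *\<^sub>R y" "v + t *\<^sub>R y"]
      by (intro bexI[of _ "s + t"]) (auto simp: algebra_simps)
  next
    fix r t :: real and x
    assume "r > 0"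
    then have "norm (r *\<^sub>R x + (r * t) *\<^sub>R y) = r * norm (x + t *\<^sub>R y)"
      by (metis abs_of_pos norm_scaleR scaleR_add_right scaleR_scaleR)
    then show "\<exists>k\<in>UNIV. norm (r *\<^sub>R x + k *\<^sub>R y) - k * norm y
        \<le> r * (norm (x + t *\<^sub>R y) - t * norm y)"
      by (intro bexI[of _ "r * t"]) (auto simp: algebra_simps)
  qed simp
  then obtain g where g: "linear g" "\<And>x. g x \<le> q x"
    using Hahn_Banach_sublinear by blast
  have *: "g x \<le> norm (x + t *\<^sub>R y) - t * norm y" for x t
    using g(2)[of x] cINF_lower[OF bdd, of t x] by (simp add: q_def)
  show thesis
  proof
    show le: "g x \<le> norm x" for x
      using *[of x 0] by simp
    have "- g y \<le> - norm y"
      using *[of "- y" 1] linear_neg[OF g(1)] by simp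
    then show "g y = norm y"
      using le[of y] by simp
  qed (fact g)
qed

section \<open>Difference quotients of the norm\<close>

definition norm_quotient :: "'a::real_normed_vector \<Rightarrow> real \<Rightarrow> 'a \<Rightarrow> real"
  where "norm_quotient y t h = (norm (y + t *\<^sub>R h) - norm y) / t"

lemma norm_quotient_ge:
  assumes "t > 0"
  shows "- norm h \<le> norm_quotient y t h"
  using assms norm_triangle_ineq4[of "y + t *\<^sub>R h" "t *\<^sub>R h"]
  by (simp add: norm_quotient_def field_simps)

lemma norm_quotient_le:
  assumes "t > 0"
  shows "norm_quotient y t h \<le> norm h"
  using assms norm_triangle_ineq[of y "t *\<^sub>R h"]
  by (simp add: norm_quotient_def field_simps)

text \<open>With step \<open>s * t / (s + t)\<close>, the point reached in direction
  \<open>h + k\<close> is the convex combination of \<open>y + s *\<^sub>R h\<close> and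
  \<open>y + t *\<^sub>R k\<close> with weights proportional to \<open>t\<close> and
  \<open>s\<close>. The estimate is thus convexity of the norm.\<close>

lemma norm_quotient_add:
  assumes "s > 0" "t > 0"
  shows "norm_quotient y (s * t / (s + t)) (h + k) \<le> norm_quotient y s h + norm_quotient y t k"
proof -
  let ?r = "s * t / (s + t)"
  have pos: "s + t > 0" "?r > 0" using assms by auto
  then have r: "(s + t) * ?r = s * t" by simp
  have "(s + t) *\<^sub>R (y + ?r *\<^sub>R (h + k)) = t *\<^sub>R (y + s *\<^sub>R h) + s *\<^sub>R (y + t *\<^sub>R k)"
    by (simp only: scaleR_add_right scaleR_scaleR r) (simp add: algebra_simps)
  then have "(s + t) * norm (y + ?r *\<^sub>R (h + k)) \<le> t * norm (y + s *\<^sub>R h) + s * norm (y + t *\<^sub>R k)"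
    using norm_triangle_ineq[of "t *\<^sub>R (y + s *\<^sub>R h)" "s *\<^sub>R (y + t *\<^sub>R k)"] assms pos
    by (metis abs_of_pos norm_scaleR)
  then have "(s + t) * (norm (y + ?r *\<^sub>R (h + k)) - norm y) / (s * t)
      \<le> (t * (norm (y + s *\<^sub>R h) - norm y) + s * (norm (y + t *\<^sub>R k) - norm y)) / (s * t)"
    using assms by (intro divide_right_mono) (auto simp: algebra_simps)
  also have "\<dots> = norm_quotient y s h + norm_quotient y t k"
    using assms by (simp add: norm_quotient_def add_divide_distrib)
  finally show ?thesis
    by (simp add: norm_quotient_def mult.commute)
qed

lemma norm_quotient_scaleR:
  assumes "r > 0" "t > 0"
  shows "norm_quotient y (t / r) (r *\<^sub>R h) = r * norm_quotient y t h"
  using assms by (simp add: norm_quotient_def)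

lemma norm_quotient_mono:
  assumes "0 < s" "s \<le> t"
  shows "norm_quotient y s h \<le> norm_quotient y t h"
proof (cases "s = t")
  case False
  \<comment> \<open>the harmonic sum in the subadditivity estimate equals \<open>s\<close> for the other step \<open>s t / (t - s)\<close>\<close>
  let ?u = "s * t / (t - s)"
  have pos: "t - s > 0" "t > 0" using assms False by auto
  then have u: "?u > 0" using assms by simp
  have "t + ?u = t * t / (t - s)"
    using pos by (simp add: field_simps)
  then have "t * ?u / (t + ?u) = s"
    using pos by simp
  then show ?thesis
    using norm_quotient_add[OF pos(2) u, of y h 0] by (simp add: norm_quotient_def)
qed simp

text \<open>This is the right derivative of the norm at \<open>y\<close>: the quotients increase
  with the step, so their limit at zero is an infimum.\<close>

definition norm_derivative :: "'a::real_normed_vector \<Rightarrow> 'a \<Rightarrow> real"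
  where "norm_derivative y h = (INF t\<in>{0<..}. norm_quotient y t h)"

lemma norm_derivative_le_quotient: "t > 0 \<Longrightarrow> norm_derivative y h \<le> norm_quotient y t h"
  unfolding norm_derivative_def
  by (intro cINF_lower bdd_belowI2[where m = "- norm h"]) (auto intro: norm_quotient_ge)

lemma norm_derivative_greatest:
  "(\<And>t. t > 0 \<Longrightarrow> c \<le> norm_quotient y t h) \<Longrightarrow> c \<le> norm_derivative y h"
  unfolding norm_derivative_def by (intro cINF_greatest) auto

lemma sublinear_norm_derivative: "sublinear (norm_derivative y)"
proof -
  have "sublinear (\<lambda>h. INF t\<in>{0<..}. norm_quotient y t h)"
  proof (rule sublinear_INF)
    show "bdd_below ((\<lambda>t. norm_quotient y t h) ` {0<..})" for h
      by (intro bdd_belowI2[where m = "- norm h"]) (auto intro: norm_quotient_ge)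
  next
    fix s t :: real and h k
    assume "s \<in> {0<..}" "t \<in> {0<..}"
    then show "\<exists>r\<in>{0<..}. norm_quotient y r (h + k) \<le> norm_quotient y s h + norm_quotient y t k"
      using norm_quotient_add[of s t y h k] by (intro bexI[of _ "s * t / (s + t)"]) auto
  next
    fix r t :: real and h
    assume "t \<in> {0<..}" "r > 0"
    then show "\<exists>s\<in>{0<..}. norm_quotient y s (r *\<^sub>R h) \<le> r * norm_quotient y t h"
      using norm_quotient_scaleR[of r t y h] by (intro bexI[of _ "t / r"]) auto
  qed auto
  then show ?thesis
    by (simp add: norm_derivative_def[abs_def])
qed

lemma norm_derivative_le_norm: "norm_derivative y h \<le> norm h"
  using norm_derivative_le_quotient[of 1 y h] norm_quotient_le[of 1 y h] by simp

lemma norm_derivative_minus_self: "norm_derivative y (- y) \<le> - norm y"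
  using norm_derivative_le_quotient[of 1 y "- y"] by (simp add: norm_quotient_def)

text \<open>The limit \<open>L\<close> is never identified with the derivative. Two quotients with
  steps below \<open>d\<close> are both within \<open>\<delta> / 2\<close> of \<open>L\<close>,
  hence within \<open>\<delta>\<close> of each other; monotonicity extends the lower bound to larger
  steps, and the infimum over all steps follows.\<close>

lemma SSD_imp_norm_derivative:
  assumes "SSD_norm TYPE('a::real_normed_vector)" "norm (y :: 'a) = 1" "\<delta> > 0"
  obtains t where "t > 0" "\<And>h. norm h \<le> 1 \<Longrightarrow> norm_quotient y t h \<le> norm_derivative y h + \<delta>"
proof -
  have "y \<in> sphere 0 1" using assms(2) by simp
  then obtain L where "uniform_limit (cball 0 1) (norm_quotient y) L (at_right 0)"
    using assms(1) unfolding SSD_norm_def norm_quotient_def[abs_def] by blast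
  then have "\<forall>\<^sub>F t in at_right 0. \<forall>h\<in>cball 0 1. dist (norm_quotient y t h) (L h) < \<delta> / 2"
    by (rule uniform_limitD) (use assms(3) in simp)
  then obtain d where d: "d > 0"
    and close: "\<And>t h. 0 < t \<Longrightarrow> t < d \<Longrightarrow> norm h \<le> 1 \<Longrightarrow> dist (norm_quotient y t h) (L h) < \<delta> / 2"
    by (auto simp: eventually_at_right_field)
  show thesis
  proof
    fix h :: 'a assume h: "norm h \<le> 1"
    have "norm_quotient y (d / 2) h - \<delta> \<le> norm_derivative y h"
    proof (rule norm_derivative_greatest)
      fix s :: real assume "s > 0"
      let ?r = "min s (d / 2)"
      have "0 < ?r" "?r < d" using \<open>s > 0\<close> d by auto
      then have "norm_quotient y (d / 2) h - \<delta> \<le> norm_quotient y ?r h"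
        using close[of ?r h] close[of "d / 2" h] d h unfolding dist_real_def by linarith
      also have "\<dots> \<le> norm_quotient y s h"
        using \<open>s > 0\<close> d by (intro norm_quotient_mono) auto
      finally show "norm_quotient y (d / 2) h - \<delta> \<le> norm_quotient y s h" .
    qed
    then show "norm_quotient y (d / 2) h \<le> norm_derivative y h + \<delta>" by simp
  qed (use d in simp)
qed

section \<open>Functionals over the scalar field\<close>

text \<open>Algebraic linearity over \<open>'k\<close> only; norm bounds are stated separately as
  explicit estimates.\<close>

definition scalar_functional ::
  "('k::real_normed_field \<Rightarrow> 'v::real_normed_vector \<Rightarrow> 'v) \<Rightarrow> ('v \<Rightarrow> 'k) \<Rightarrow> bool"
  where "scalar_functional s F \<longleftrightarrow>
    (\<forall>x y. F (x + y) = F x + F y) \<and> (\<forall>c x. F (s c x) = c * F x)"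

text \<open>The unimodular scalar \<open>inverse (sgn c)\<close> rotates \<open>c\<close> onto the
  positive real axis, which lets real parts control absolute values.\<close>

lemma inverse_sgn_mult:
  fixes c :: "'k::real_normed_field"
  assumes "c \<noteq> 0"
  shows "norm (inverse (sgn c)) = 1" "inverse (sgn c) * c = of_real (norm c)"
proof -
  show "norm (inverse (sgn c)) = 1"
    using assms by (simp add: norm_inverse norm_sgn)
  show "inverse (sgn c) * c = of_real (norm c)"
    using assms by (simp add: sgn_div_norm scaleR_conv_of_real field_simps)
qed

text \<open>
  Real and complex scalars are treated together: the identity \<open>norm_one_minus\<close> determines the real part
  \<open>re\<close>, and over \<open>complex\<close> the functional in \<open>re_lift\<close> is \<open>z \<mapsto> u z - \<i> u (\<i> z)\<close>.
\<close>

locale scalar_real_part = normed_space_over scale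
  for scale :: "'k::real_normed_field \<Rightarrow> 'v::real_normed_vector \<Rightarrow> 'v" +
  fixes re :: "'k \<Rightarrow> real"
  assumes linear_re: "linear re"
    and norm_one_minus: "(norm (1 - c))\<^sup>2 = 1 - 2 * re c + (norm c)\<^sup>2"
    and re_lift: "linear u \<Longrightarrow> \<exists>F. scalar_functional scale F \<and> (\<forall>z. re (F z) = u z)"
begin

text \<open>Squaring \<open>\<bar>1 - norm c\<bar> \<le> norm (1 - c)\<close> and expanding the
  right side by \<open>norm_one_minus\<close> leaves exactly this inequality.\<close>

lemma re_le_norm: "re c \<le> norm c"
proof -
  have "(1 - norm c)\<^sup>2 \<le> (norm (1 - c))\<^sup>2"
    using norm_triangle_ineq3[of 1 c] by (simp flip: abs_le_square_iff)
  then show ?thesis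
    unfolding norm_one_minus by (simp add: power2_eq_square algebra_simps)
qed

lemma re_of_real: "re (of_real r) = r"
proof -
  have "norm (1 - of_real r :: 'k) = \<bar>1 - r\<bar>"
    by (metis norm_of_real of_real_1 of_real_diff)
  then show ?thesis
    using norm_one_minus[of "of_real r"] by (simp add: power2_eq_square algebra_simps)
qed

text \<open>By \<open>norm_one_minus\<close>, the squared distance from \<open>c\<close> to 1 is
  \<open>(norm c)\<^sup>2 - 1\<close>, which is at most zero.\<close>

lemma re_eq_one_imp:
  assumes "re c = 1" "norm c \<le> 1"
  shows "c = 1"
proof -
  have "(norm (1 - c))\<^sup>2 \<le> 0"
    using assms abs_square_le_1[of "norm c"] by (simp add: norm_one_minus)
  then show ?thesis by simp
qed

lemma scalar_functional_linear:
  assumes "scalar_functional scale F"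
  shows "linear F"
proof (rule linearI)
  fix r x
  have "F (scale (of_real r) x) = of_real r * F x"
    using assms unfolding scalar_functional_def by blast
  then show "F (r *\<^sub>R x) = r *\<^sub>R F x"
    by (simp add: scale_of_real scaleR_conv_of_real)
qed (use assms in \<open>auto simp: scalar_functional_def\<close>)

text \<open>Multiplying \<open>z\<close> by a unimodular scalar keeps its norm and makes
  \<open>F z\<close> real and nonnegative, so the bound on the real part already bounds the
  modulus.\<close>

lemma norm_functional_le:
  assumes F: "scalar_functional scale F" and re: "\<And>z. re (F z) \<le> c * norm z"
  shows "norm (F z) \<le> c * norm z"
proof (cases "F z = 0")
  case True
  have "re (F z) \<le> c * norm z" by (rule re)
  then show ?thesis using True linear_0[OF linear_re] by simp
next
  case False
  let ?s = "inverse (sgn (F z))"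
  have s: "norm ?s = 1" "?s * F z = of_real (norm (F z))"
    by (rule inverse_sgn_mult[OF False])+
  have "norm (F z) = re (F (scale ?s z))"
    using F s(2) unfolding scalar_functional_def by (metis re_of_real)
  also have "\<dots> \<le> c * norm z"
    using re[of "scale ?s z"] s(1) by (simp add: norm_scale)
  finally show ?thesis .
qed

text \<open>The threshold is \<open>\<epsilon> * t / 2\<close> for a step \<open>t\<close> at which
  the quotients are uniformly within \<open>\<epsilon> / 2\<close> of the derivative. After division
  by \<open>t\<close>, the defect of \<open>F\<close> at \<open>y\<close> costs the other
  \<open>\<epsilon> / 2\<close>.\<close>

lemma SSD_imp_near_supporting_functional:
  assumes SSD: "SSD_norm TYPE('v)" and y: "norm (y :: 'v) = 1" and \<epsilon>: "\<epsilon> > 0"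
  obtains \<eta> where "\<eta> > 0" and
    "\<And>F. scalar_functional scale F \<Longrightarrow> (\<And>z. norm (F z) \<le> norm z) \<Longrightarrow> re (F y) > 1 - \<eta> \<Longrightarrow>
      \<exists>G. scalar_functional scale G \<and> (\<forall>z. norm (G z) \<le> norm z) \<and> G y = 1 \<and>
        (\<forall>z. norm (G z - F z) \<le> \<epsilon> * norm z)"
proof -
  obtain t where t: "t > 0"
    and tL: "\<And>h. norm h \<le> 1 \<Longrightarrow> norm_quotient y t h \<le> norm_derivative y h + \<epsilon> / 2"
    using SSD_imp_norm_derivative[OF SSD y, of "\<epsilon> / 2"] \<epsilon> by auto
  have "\<exists>G. scalar_functional scale G \<and> (\<forall>z. norm (G z) \<le> norm z) \<and> G y = 1 \<and>
        (\<forall>z. norm (G z - F z) \<le> \<epsilon> * norm z)"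
    if F: "scalar_functional scale F" and F_le: "\<And>z. norm (F z) \<le> norm z"
      and Fy: "re (F y) > 1 - \<epsilon> * t / 2" for F
  proof -
    define f where "f z = re (F z)" for z
    have f: "linear f"
      using linear_compose[OF scalar_functional_linear[OF F] linear_re]
      by (simp add: f_def[abs_def] o_def)
    have f_le: "f z \<le> norm z" for z
      using re_le_norm[of "F z"] F_le[of z] by (simp add: f_def)
    have ball: "f h \<le> norm_derivative y h + \<epsilon>" if "norm h \<le> 1" for h
    proof -
      have "t * f h = f (y + t *\<^sub>R h) - f y"
        by (simp add: linear_add[OF f] linear_scale[OF f])
      also have "\<dots> \<le> norm (y + t *\<^sub>R h) - norm y + \<epsilon> * t / 2"
        using f_le[of "y + t *\<^sub>R h"] Fy y by (simp add: f_def)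
      also have "\<dots> = t * (norm_quotient y t h + \<epsilon> / 2)"
        using t by (simp add: norm_quotient_def field_simps)
      finally have "f h \<le> norm_quotient y t h + \<epsilon> / 2"
        using t by simp
      then show ?thesis using tL[OF that] by simp
    qed
    have f_le_L: "f h \<le> norm_derivative y h + \<epsilon> * norm h" for h
    proof (cases "h = 0")
      case True
      then show ?thesis using linear_0[OF f] sublinear_zero[OF sublinear_norm_derivative[of y]] by simp
    next
      case False
      then have "f (inverse (norm h) *\<^sub>R h) \<le> norm_derivative y (inverse (norm h) *\<^sub>R h) + \<epsilon>"
        by (intro ball) simp
      then show ?thesis
        using False sublinear_scaleR[OF sublinear_norm_derivative, of "inverse (norm h)" y h]
        by (simp add: linear_scale[OF f] field_simps)
    qed
    \<comment> \<open>Lying below \<open>q\<close> means being within \<open>\<epsilon>\<close> of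
      \<open>f\<close>, and lying below the derivative means supporting the ball at
      \<open>y\<close>. The sandwich condition for the two is \<open>f_le_L\<close>.\<close>
    define q where "q h = f h + \<epsilon> * norm h" for h
    have q: "sublinear q"
      unfolding sublinear_def q_def
    proof (intro conjI allI impI)
      show "f (h + k) + \<epsilon> * norm (h + k) \<le> f h + \<epsilon> * norm h + (f k + \<epsilon> * norm k)" for h k
        using mult_left_mono[OF norm_triangle_ineq[of h k], of \<epsilon>] \<epsilon>
        by (simp add: linear_add[OF f] distrib_left)
      show "f (r *\<^sub>R h) + \<epsilon> * norm (r *\<^sub>R h) \<le> r * (f h + \<epsilon> * norm h)" if "r > 0" for r h
        using that by (simp add: linear_scale[OF f] algebra_simps)
    qed
    have "0 \<le> norm_derivative y h + q (- h)" for h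
      using f_le_L[of h] by (simp add: q_def linear_neg[OF f])
    then obtain g where g: "linear g" and gL: "\<And>h. g h \<le> norm_derivative y h"
      and gq: "\<And>h. g h \<le> q h"
      using Hahn_Banach_sandwich[OF sublinear_norm_derivative q] by blast
    obtain G where G: "scalar_functional scale G" and reG: "\<And>z. re (G z) = g z"
      using re_lift[OF g] by blast
    have g_le: "g z \<le> norm z" for z
      using gL norm_derivative_le_norm order_trans by blast
    have G_le: "norm (G z) \<le> norm z" for z
      using norm_functional_le[OF G, of 1 z] reG g_le by simp
    \<comment> \<open>The lower bound comes from direction \<open>- y\<close>, where the derivative
      is at most \<open>- norm y\<close>.\<close>
    have "g y = 1"
      using g_le[of y] gL[of "- y"] norm_derivative_minus_self[of y] y linear_neg[OF g] by simp
    then have "G y = 1"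
      using re_eq_one_imp reG G_le[of y] y by simp
    moreover have "norm (G z - F z) \<le> \<epsilon> * norm z" for z
    proof (rule norm_functional_le)
      show "scalar_functional scale (\<lambda>z. G z - F z)"
        using F G by (simp add: scalar_functional_def algebra_simps)
      show "re (G z - F z) \<le> \<epsilon> * norm z" for z
        using gq[of z] by (simp add: linear_diff[OF linear_re] reG q_def f_def)
    qed
    ultimately show ?thesis using G G_le by blast
  qed
  then show thesis
    using t \<epsilon> by (intro that[of "\<epsilon> * t / 2"]) auto
qed

end

section \<open>Bilinear forms\<close>

lemma bounded_bilinear_diff:
  assumes "bounded_bilinear f" "bounded_bilinear g"
  shows "bounded_bilinear (\<lambda>x y. f x y - g x y)"
proof -
  interpret f: bounded_bilinear f by (rule assms)
  interpret g: bounded_bilinear g by (rule assms)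
  show ?thesis
  proof
    obtain K K' where K: "\<And>x y. norm (f x y) \<le> norm x * norm y * K"
      and K': "\<And>x y. norm (g x y) \<le> norm x * norm y * K'"
      using f.bounded g.bounded by blast
    have "norm (f x y - g x y) \<le> norm x * norm y * (K + K')" for x y
      using norm_triangle_ineq4[of "f x y" "g x y"] K[of x y] K'[of x y]
      by (simp add: distrib_left)
    then show "\<exists>K. \<forall>x y. norm (f x y - g x y) \<le> norm x * norm y * K"
      by blast
  qed (simp_all add: f.add_left f.add_right g.add_left g.add_right
      f.scaleR_left f.scaleR_right g.scaleR_left g.scaleR_right scaleR_right_diff_distrib)
qed

text \<open>For nonzero \<open>x\<close> and \<open>y\<close> both arguments are normalised by
  \<open>sgn\<close>, and boundedness makes the supremum an upper bound. Otherwise both sides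
  vanish.\<close>

lemma norm_le_form_norm:
  assumes A: "bounded_bilinear A"
  shows "norm (A x y) \<le> form_norm A * (norm x * norm y)"
proof (cases "x = 0 \<or> y = 0")
  case True
  then show ?thesis
    using bounded_bilinear.zero_left[OF A] bounded_bilinear.zero_right[OF A] by auto
next
  case False
  obtain K where K: "\<And>x y. norm (A x y) \<le> norm x * norm y * K"
    using bounded_bilinear.bounded[OF A] by blast
  have "bdd_above ((\<lambda>(x, y). norm (A x y)) ` (sphere 0 1 \<times> sphere 0 1))"
  proof (rule bdd_aboveI2)
    show "(case z of (x, y) \<Rightarrow> norm (A x y)) \<le> K" if "z \<in> sphere 0 1 \<times> sphere 0 1" for z
      using that K[of "fst z" "snd z"] by (auto split: prod.splits)
  qed
  then have "norm (A (sgn x) (sgn y)) \<le> form_norm A"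
    unfolding form_norm_def
    using cSUP_upper[of "(sgn x, sgn y)" "sphere 0 1 \<times> sphere 0 1" "\<lambda>(x, y). norm (A x y)"] False
    by (simp add: norm_sgn)
  moreover have "norm (A (sgn x) (sgn y)) = norm (A x y) / (norm x * norm y)"
    by (simp add: sgn_div_norm bounded_bilinear.scaleR_left[OF A]
        bounded_bilinear.scaleR_right[OF A] divide_inverse mult_ac)
  ultimately show ?thesis
    using False by (simp add: divide_simps)
qed

text \<open>The vectors \<open>x0\<close> and \<open>y0\<close> witness that the supremum is taken
  over a nonempty set.\<close>

lemma form_norm_le:
  assumes "norm (x0 :: 'x::real_normed_vector) = 1" "norm (y0 :: 'y::real_normed_vector) = 1"
    and "\<And>x y. norm (A x y) \<le> c * (norm x * norm y)"
  shows "form_norm (A :: 'x \<Rightarrow> 'y \<Rightarrow> 'k::real_normed_field) \<le> c"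
  unfolding form_norm_def
proof (rule cSUP_least)
  show "sphere (0 :: 'x) 1 \<times> sphere (0 :: 'y) 1 \<noteq> {}"
    using assms(1,2) by auto
  show "(case z of (x, y) \<Rightarrow> norm (A x y)) \<le> c" if "z \<in> sphere 0 1 \<times> sphere 0 1" for z
    using that assms(3)[of "fst z" "snd z"] by (auto split: prod.splits)
qed

lemma form_norm_eq_1:
  assumes "bounded_bilinear A" "norm x0 = 1" "norm y0 = 1" "norm (A x0 y0) = 1"
    and "\<And>x y. norm (A x y) \<le> norm x * norm y"
  shows "form_norm A = 1"
  using form_norm_le[OF assms(2,3), of A 1] norm_le_form_norm[OF assms(1), of x0 y0] assms by simp

section \<open>Forms on \<open>ell1\<close> as tuples of functionals\<close>

definition basis_ell1 :: "'n \<Rightarrow> ('k::real_normed_field, 'n::finite) ell1"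
  where "basis_ell1 j = of_coords (axis j 1)"

lemma coords_basis_ell1: "coords (basis_ell1 j) = axis j 1"
  by (simp add: basis_ell1_def of_coords_inverse)

lemma norm_ell1: "norm (x :: ('k::real_normed_field, 'n::finite) ell1) = (\<Sum>j\<in>UNIV. norm (coords x $ j))"
  by (rule norm_ell1.rep_eq)

lemma norm_basis_ell1: "norm (basis_ell1 j :: ('k::real_normed_field, 'n::finite) ell1) = 1"
  by (simp add: norm_ell1 coords_basis_ell1 axis_def if_distrib[of norm] cong: if_cong)

lemma ell1_expansion:
  "x = (\<Sum>j\<in>UNIV. scale_ell1 (coords x $ j) (basis_ell1 j :: ('k::real_normed_field, 'n::finite) ell1))"
proof -
  have coords_sum: "coords (\<Sum>j\<in>J. f j) = (\<Sum>j\<in>J. coords (f j))"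
    for J and f :: "'n \<Rightarrow> ('k, 'n) ell1"
    by (induction J rule: infinite_finite_induct) (auto simp: zero_ell1.rep_eq plus_ell1.rep_eq)
  show ?thesis
    unfolding coords_inject[symmetric]
    by (simp add: coords_sum scale_ell1.rep_eq coords_basis_ell1 vec_eq_iff axis_def
        if_distrib[of "(*) _"] cong: if_cong)
qed

text \<open>A form is recovered from its functionals \<open>A (basis_ell1 j)\<close>;
  \<open>bounded_bilinear_form_ell1\<close> goes back from a tuple of functionals to a form.\<close>

lemma bounded_bilinear_form_ell1_expansion:
  assumes "bounded_bilinear_form scale_ell1 s A"
  shows "A x y = (\<Sum>j\<in>UNIV. coords x $ j * A (basis_ell1 j) y)"
proof -
  have A: "bounded_bilinear A" "\<And>c x y. A (scale_ell1 c x) y = c * A x y"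
    using assms by (auto simp: bounded_bilinear_form_def)
  show ?thesis
    by (subst ell1_expansion[of x]) (simp add: bounded_bilinear.sum_left[OF A(1)] A(2))
qed

lemma ell1_form_le:
  assumes "\<And>j. norm (F j :: 'k::real_normed_field) \<le> c"
  shows "norm (\<Sum>j\<in>UNIV. coords (x :: ('k, 'n::finite) ell1) $ j * F j) \<le> c * norm x"
proof -
  have "norm (\<Sum>j\<in>UNIV. coords x $ j * F j) \<le> (\<Sum>j\<in>UNIV. norm (coords x $ j) * c)"
    using assms by (intro sum_norm_le) (simp add: norm_mult mult_left_mono)
  then show ?thesis
    by (simp only: norm_ell1 sum_distrib_right mult.commute[of c])
qed

context normed_space_over
begin

lemma bounded_bilinear_form_ell1:
  fixes F :: "'n::finite \<Rightarrow> 'v \<Rightarrow> 'k"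
  assumes F: "\<And>j. scalar_functional scale (F j)" and F_le: "\<And>j z. norm (F j z) \<le> c * norm z"
  defines "B \<equiv> \<lambda>x z. \<Sum>j\<in>UNIV. coords (x :: ('k, 'n) ell1) $ j * F j z"
  shows "bounded_bilinear_form scale_ell1 scale B" "norm (B x z) \<le> c * (norm x * norm z)"
proof -
  show B_le: "norm (B x z) \<le> c * (norm x * norm z)" for x z
    using ell1_form_le[of "\<lambda>j. F j z" "c * norm z" x] F_le by (simp add: B_def mult_ac)
  have add: "F j (z + w) = F j z + F j w" and mult: "F j (scale a z) = a * F j z" for j z w a
    using F by (auto simp: scalar_functional_def)
  have real: "F j (r *\<^sub>R z) = r *\<^sub>R F j z" for j r z
    using mult[of j "of_real r" z] by (simp add: scale_of_real scaleR_conv_of_real)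
  have "bounded_bilinear B"
  proof
    show "\<exists>K. \<forall>x z. norm (B x z) \<le> norm x * norm z * K"
      using B_le by (intro exI[of _ c]) (simp add: mult_ac)
  qed (simp_all add: B_def plus_ell1.rep_eq scaleR_ell1.rep_eq add real algebra_simps
      sum.distrib scaleR_sum_right)
  then show "bounded_bilinear_form scale_ell1 scale B"
    by (simp add: bounded_bilinear_form_def B_def scale_ell1.rep_eq mult sum_distrib_left mult_ac)
qed

lemma scalar_functional_partial:
  assumes "bounded_bilinear_form s1 scale A"
  shows "scalar_functional scale (A x)"
  using assms bounded_bilinear.add_right[of A]
  by (auto simp: bounded_bilinear_form_def scalar_functional_def)

lemma scalar_functional_mult:
  "scalar_functional scale F \<Longrightarrow> scalar_functional scale (\<lambda>z. c * F z)"
  by (simp add: scalar_functional_def algebra_simps)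

end

section \<open>The equivalence\<close>

context scalar_real_part
begin

text \<open>If \<open>A\<close> almost norms \<open>(x, y)\<close>, then each functional
  \<open>A (basis_ell1 j)\<close> with a nonzero coordinate of \<open>x\<close> almost norms
  \<open>y\<close> up to a phase. These are replaced by supporting functionals with matching phases;
  the others are kept.\<close>

lemma SSD_imp_property_Lpp:
  assumes SSD: "SSD_norm TYPE('v)"
  shows "property_Lpp (scale_ell1 :: 'k \<Rightarrow> ('k, 'n::finite) ell1 \<Rightarrow> _) scale"
  unfolding property_Lpp_def
proof (intro allI impI ballI)
  fix \<epsilon> :: real and x :: "('k, 'n) ell1" and y :: 'v
  assume \<epsilon>: "\<epsilon> > 0" and "x \<in> sphere 0 1" "y \<in> sphere 0 1"
  then have x: "norm x = 1" and y: "norm y = 1" by auto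
  let ?x = "\<lambda>j. coords x $ j"
  obtain \<eta> where \<eta>: "\<eta> > 0" and near:
    "\<And>F. scalar_functional scale F \<Longrightarrow> (\<And>z. norm (F z) \<le> norm z) \<Longrightarrow> re (F y) > 1 - \<eta> \<Longrightarrow>
      \<exists>G. scalar_functional scale G \<and> (\<forall>z. norm (G z) \<le> norm z) \<and> G y = 1 \<and>
        (\<forall>z. norm (G z - F z) \<le> \<epsilon> / 2 * norm z)"
    using SSD_imp_near_supporting_functional[OF SSD y, of "\<epsilon> / 2"] \<epsilon> by auto
  \<comment> \<open>The smallest nonzero modulus among the coordinates; inserting 1 keeps the set
    nonempty without a case distinction.\<close>
  obtain m where m: "m > 0" "\<And>j. ?x j \<noteq> 0 \<Longrightarrow> m \<le> norm (?x j)"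
  proof
    let ?M = "Min (insert 1 ((\<lambda>j. norm (?x j)) ` {j. ?x j \<noteq> 0}))"
    show "?M > 0" by (subst Min_gr_iff) auto
    show "?M \<le> norm (?x j)" if "?x j \<noteq> 0" for j
      using that by (intro Min_le) auto
  qed
  show "\<exists>\<eta>'>0. \<forall>A. bounded_bilinear_form scale_ell1 scale A \<and> form_norm A = 1 \<and>
      norm (A x y) > 1 - \<eta>' \<longrightarrow>
      (\<exists>B. bounded_bilinear_form scale_ell1 scale B \<and> form_norm B = 1 \<and> norm (B x y) = 1 \<and>
        form_norm (\<lambda>x y. B x y - A x y) < \<epsilon>)"
  \<comment> \<open>The bound 1 ensures \<open>A x y\<close> is nonzero, so its phase is invertible;
    \<open>\<eta> * m\<close> leaves each relevant functional a defect below
    \<open>\<eta>\<close>.\<close>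
  proof (intro exI[of _ "min 1 (\<eta> * m)"] conjI allI impI)
    show "min 1 (\<eta> * m) > 0" using \<eta> m by simp
    fix A
    assume "bounded_bilinear_form scale_ell1 scale A \<and> form_norm A = 1 \<and>
      norm (A x y) > 1 - min 1 (\<eta> * m)"
    then have A: "bounded_bilinear_form scale_ell1 scale A" and A1: "form_norm A = 1"
      and A_nz: "norm (A x y) > 0" and A_gt: "norm (A x y) > 1 - \<eta> * m"
      by auto
    have A_le: "norm (A u z) \<le> norm u * norm z" for u z
      using norm_le_form_norm[of A u z] A A1 by (simp add: bounded_bilinear_form_def)
    define F where "F j = A (basis_ell1 j)" for j
    have F: "scalar_functional scale (F j)" for j
      unfolding F_def by (rule scalar_functional_partial[OF A])
    have F_le: "norm (F j z) \<le> norm z" for j z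
      using A_le[of "basis_ell1 j" z] by (simp add: F_def norm_basis_ell1)
    define s where "s = inverse (sgn (A x y))"
    have s: "norm s = 1" "s * A x y = of_real (norm (A x y))"
      using A_nz inverse_sgn_mult[of "A x y"] by (auto simp: s_def)
    \<comment> \<open>The other summands are at most the moduli of their coordinates, which add up
      to \<open>1 - norm (?x i)\<close>. A single coordinate can thus fall short by no more than the
      total defect.\<close>
    have re_i: "re (s * (?x i * F i y)) > norm (?x i) - \<eta> * m" for i
    proof -
      have le: "re (s * (?x j * F j y)) \<le> norm (?x j)" for j
        using re_le_norm[of "s * (?x j * F j y)"] s(1) F_le[of j y] y
          mult_left_le[of "norm (F j y)" "norm (?x j)"]
        by (simp add: norm_mult)
      have "norm (A x y) = re (s * A x y)"
        by (simp add: s(2) re_of_real)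
      also have "s * A x y = (\<Sum>j\<in>UNIV. s * (?x j * F j y))"
        by (simp add: bounded_bilinear_form_ell1_expansion[OF A, of x y] F_def sum_distrib_left)
      also have "re \<dots> = re (s * (?x i * F i y)) + (\<Sum>j\<in>UNIV - {i}. re (s * (?x j * F j y)))"
        by (simp add: sum.remove[of UNIV i] linear_add[OF linear_re] linear_sum[OF linear_re])
      also have "\<dots> \<le> re (s * (?x i * F i y)) + (\<Sum>j\<in>UNIV - {i}. norm (?x j))"
        by (intro add_left_mono sum_mono le)
      also have "\<dots> = re (s * (?x i * F i y)) + (1 - norm (?x i))"
        using x by (simp add: norm_ell1 sum.remove[of UNIV i])
      finally show ?thesis using A_gt by simp
    qed
    \<comment> \<open>The prescribed phase at \<open>y\<close> makes all summands of
      \<open>s * B x y\<close> nonnegative reals, so they add up to \<open>norm x\<close> without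
      cancellation.\<close>
    have "\<exists>G. scalar_functional scale G \<and> (\<forall>z. norm (G z) \<le> norm z) \<and>
        s * (?x j * G y) = of_real (norm (?x j)) \<and>
        (\<forall>z. norm (G z - F j z) \<le> \<epsilon> / 2 * norm z)" for j
    proof (cases "?x j = 0")
      case True
      then show ?thesis using F[of j] F_le[of j] \<epsilon> by (intro exI[of _ "F j"]) auto
    next
      case False
      \<comment> \<open>Rotation by \<open>u\<close> turns the almost norming \<open>F j\<close>
        into one with real part near 1 at \<open>y\<close>; \<open>inverse u\<close> undoes it after
        the replacement.\<close>
      define u where "u = s * sgn (?x j)"
      have u: "norm u = 1" using False s(1) by (simp add: u_def norm_mult norm_sgn)
      then have "u \<noteq> 0" by auto
      have xu: "s * ?x j = of_real (norm (?x j)) * u"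
        using False by (simp add: u_def sgn_div_norm scaleR_conv_of_real)
      have "norm (?x j) * re (u * F j y) = re (s * (?x j * F j y))"
        using xu linear_scale[OF linear_re, of "norm (?x j)" "u * F j y"]
        by (simp add: scaleR_conv_of_real mult.assoc[symmetric])
      also have "\<dots> > norm (?x j) - \<eta> * m" by (rule re_i)
      finally have "norm (?x j) * (1 - re (u * F j y)) < \<eta> * m"
        by (simp add: algebra_simps)
      also have "\<dots> \<le> norm (?x j) * \<eta>"
        using m(2)[OF False] \<eta> by (simp add: mult.commute)
      finally have "re (u * F j y) > 1 - \<eta>"
        using False by simp
      moreover have "norm (u * F j z) \<le> norm z" for z
        using F_le[of j z] u by (simp add: norm_mult)
      ultimately obtain G where G: "scalar_functional scale G" "\<And>z. norm (G z) \<le> norm z" "G y = 1"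
          "\<And>z. norm (G z - u * F j z) \<le> \<epsilon> / 2 * norm z"
        using near[OF scalar_functional_mult[OF F, of u]] by blast
      have "inverse u * G z - F j z = inverse u * (G z - u * F j z)" for z
        using \<open>u \<noteq> 0\<close> by (simp add: field_simps)
      then have "norm (inverse u * G z - F j z) \<le> \<epsilon> / 2 * norm z" for z
        using G(4)[of z] u by (simp add: norm_mult norm_inverse)
      moreover have "s * (?x j * (inverse u * G y)) = of_real (norm (?x j))"
        using xu \<open>u \<noteq> 0\<close> G(3) by (simp add: mult.assoc[symmetric])
      moreover have "norm (inverse u * G z) \<le> norm z" for z
        using G(2)[of z] u by (simp add: norm_mult norm_inverse)
      ultimately show ?thesis
        using scalar_functional_mult[OF G(1), of "inverse u"] by blast
    qed
    then obtain G where G: "\<And>j. scalar_functional scale (G j)" "\<And>j z. norm (G j z) \<le> norm z"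
        "\<And>j. s * (?x j * G j y) = of_real (norm (?x j))"
        "\<And>j z. norm (G j z - F j z) \<le> \<epsilon> / 2 * norm z"
      by metis
    define B where "B u z = (\<Sum>j\<in>UNIV. coords u $ j * G j z)" for u :: "('k, 'n) ell1" and z
    have B: "bounded_bilinear_form scale_ell1 scale B"
      and B_le: "norm (B u z) \<le> norm u * norm z" for u z
      unfolding B_def[abs_def]
      using bounded_bilinear_form_ell1[of G 1] G(1,2) by auto
    have "s * B x y = of_real (norm x)"
      by (simp add: B_def sum_distrib_left G(3) norm_ell1)
    then have Bxy: "norm (B x y) = 1"
      using s(1) x by (metis mult_1 norm_mult norm_one of_real_1)
    have "norm (B u z - A u z) \<le> \<epsilon> / 2 * (norm u * norm z)" for u z
    proof -
      have "B u z - A u z = (\<Sum>j\<in>UNIV. coords u $ j * (G j z - F j z))"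
        by (simp add: B_def F_def bounded_bilinear_form_ell1_expansion[OF A, of u z]
            sum_subtractf right_diff_distrib)
      then show ?thesis
        using ell1_form_le[of "\<lambda>j. G j z - F j z" "\<epsilon> / 2 * norm z" u] G(4) by (simp add: mult_ac)
    qed
    \<comment> \<open>Working with \<open>\<epsilon> / 2\<close> throughout compensates for the
      supremum giving only a weak inequality.\<close>
    then have "form_norm (\<lambda>u z. B u z - A u z) \<le> \<epsilon> / 2"
      by (intro form_norm_le[OF x y])
    moreover have "form_norm B = 1"
      using B B_le Bxy by (intro form_norm_eq_1[OF _ x y]) (auto simp: bounded_bilinear_form_def)
    ultimately show "\<exists>B. bounded_bilinear_form scale_ell1 scale B \<and> form_norm B = 1 \<and>
        norm (B x y) = 1 \<and> form_norm (\<lambda>x y. B x y - A x y) < \<epsilon>"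
      using B Bxy \<epsilon> by (intro exI[of _ B]) auto
  qed
qed

text \<open>The property is tested at a basis vector \<open>e\<close>, where restricting a form to
  \<open>e\<close> gives a functional on the second space. The point \<open>w\<close> guarantees
  that the form built from \<open>F\<close> has norm exactly one.\<close>

lemma property_Lpp_imp_near_supporting_functional:
  assumes L: "property_Lpp (scale_ell1 :: 'k \<Rightarrow> ('k, 'n::finite) ell1 \<Rightarrow> _) scale"
    and y: "norm (y :: 'v) = 1" and \<epsilon>: "\<epsilon> > 0"
  obtains \<eta> where "\<eta> > 0" and
    "\<And>F w. scalar_functional scale F \<Longrightarrow> (\<And>z. norm (F z) \<le> norm z) \<Longrightarrow> norm w = 1 \<Longrightarrow>
      norm (F w) = 1 \<Longrightarrow> norm (F y) > 1 - \<eta> \<Longrightarrow>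
      \<exists>G. scalar_functional scale G \<and> (\<forall>z. norm (G z) \<le> norm z) \<and> norm (G y) = 1 \<and>
        (\<forall>z. norm (G z - F z) \<le> \<epsilon> * norm z)"
proof -
  \<comment> \<open>\<open>undefined\<close> is just an arbitrary index.\<close>
  define e :: "('k, 'n) ell1" where "e = basis_ell1 undefined"
  have e: "norm e = 1" by (simp add: e_def norm_basis_ell1)
  have "e \<in> sphere 0 1" "y \<in> sphere 0 1" using e y by auto
  from L[unfolded property_Lpp_def, rule_format, OF \<epsilon> this]
  obtain \<eta> where \<eta>: "\<eta> > 0" and near: "\<And>A :: ('k, 'n) ell1 \<Rightarrow> 'v \<Rightarrow> 'k.
      bounded_bilinear_form scale_ell1 scale A \<Longrightarrow> form_norm A = 1 \<Longrightarrow> norm (A e y) > 1 - \<eta> \<Longrightarrow>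
      \<exists>B. bounded_bilinear_form scale_ell1 scale B \<and> form_norm B = 1 \<and> norm (B e y) = 1 \<and>
        form_norm (\<lambda>x y. B x y - A x y) < \<epsilon>"
    by blast
  show thesis
  proof (rule that[OF \<eta>])
    fix F w
    assume F: "scalar_functional scale F" and F_le: "\<And>z. norm (F z) \<le> norm z"
      and w: "norm w = 1" "norm (F w) = 1" and Fy: "norm (F y) > 1 - \<eta>"
    \<comment> \<open>The constant tuple with entry \<open>F\<close>; its maximum norm is that of
      \<open>F\<close>.\<close>
    define A where "A x z = (\<Sum>j\<in>UNIV. coords x $ j * F z)" for x :: "('k, 'n) ell1" and z
    have A: "bounded_bilinear_form scale_ell1 scale A"
      and A_le: "norm (A x z) \<le> norm x * norm z" for x z
      unfolding A_def[abs_def]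
      using bounded_bilinear_form_ell1[of "\<lambda>_. F" 1] F F_le by auto
    have Ae: "A e z = F z" for z
      by (simp add: A_def e_def coords_basis_ell1 axis_def if_distrib[of "\<lambda>c. c * _"] cong: if_cong)
    have "form_norm A = 1"
      using A A_le w by (intro form_norm_eq_1[OF _ e w(1)]) (auto simp: Ae bounded_bilinear_form_def)
    then obtain B where B: "bounded_bilinear_form scale_ell1 scale B" "form_norm B = 1"
        "norm (B e y) = 1" "form_norm (\<lambda>x y. B x y - A x y) < \<epsilon>"
      using near[OF A] Fy by (auto simp: Ae)
    have "norm (B e z) \<le> norm z" for z
      using norm_le_form_norm[of B e z] B e by (simp add: bounded_bilinear_form_def)
    moreover have "norm (B e z - F z) \<le> \<epsilon> * norm z" for z
    proof -
      have "bounded_bilinear (\<lambda>x y. B x y - A x y)"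
        using A B(1) by (intro bounded_bilinear_diff) (auto simp: bounded_bilinear_form_def)
      from norm_le_form_norm[OF this, of e z] show ?thesis
        using B(4) e mult_right_mono[of "form_norm (\<lambda>x y. B x y - A x y)" \<epsilon> "norm z"]
        by (simp add: Ae)
    qed
    ultimately show "\<exists>G. scalar_functional scale G \<and> (\<forall>z. norm (G z) \<le> norm z) \<and>
        norm (G y) = 1 \<and> (\<forall>z. norm (G z - F z) \<le> \<epsilon> * norm z)"
      using scalar_functional_partial[OF B(1), of e] B(3) by (intro exI[of _ "B e"]) auto
  qed
qed

text \<open>A functional supporting the ball at \<open>y\<close> lies below every difference
  quotient, hence below their infimum.\<close>

lemma re_supporting_le_norm_derivative:
  assumes G: "scalar_functional scale G" and G_le: "\<And>z. norm (G z) \<le> norm z"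
    and Gy: "G y = 1" and y: "norm y = 1"
  shows "re (G h) \<le> norm_derivative y h"
proof (rule norm_derivative_greatest)
  fix t :: real assume t: "t > 0"
  have "t * re (G h) = re (G (y + t *\<^sub>R h)) - 1"
    using re_of_real[of 1] Gy linear_scale[OF linear_re]
    by (simp add: linear_add[OF scalar_functional_linear[OF G]]
        linear_scale[OF scalar_functional_linear[OF G]] linear_add[OF linear_re])
  also have "\<dots> \<le> norm (y + t *\<^sub>R h) - norm y"
    using re_le_norm[of "G (y + t *\<^sub>R h)"] G_le[of "y + t *\<^sub>R h"] y by simp
  finally show "re (G h) \<le> norm_quotient y t h"
    using t by (simp add: norm_quotient_def field_simps)
qed

text \<open>The quotient is never below the derivative. From above it is bounded by
  \<open>u h\<close> for a functional \<open>u\<close> norming \<open>y + t *\<^sub>R h\<close>, and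
  the property places \<open>u\<close> near a functional below the derivative, with an error
  independent of \<open>h\<close>.\<close>

lemma property_Lpp_imp_SSD:
  assumes L: "property_Lpp (scale_ell1 :: 'k \<Rightarrow> ('k, 'n::finite) ell1 \<Rightarrow> _) scale"
  shows "SSD_norm TYPE('v)"
  unfolding SSD_norm_def
proof (intro ballI exI)
  fix y :: 'v assume "y \<in> sphere 0 1"
  then have y: "norm y = 1" by simp
  have "uniform_limit (cball 0 1) (norm_quotient y) (norm_derivative y) (at_right 0)"
    unfolding uniform_limit_iff
  proof (intro allI impI)
    fix \<epsilon> :: real assume \<epsilon>: "\<epsilon> > 0"
    \<comment> \<open>The errors below add up to \<open>4 * \<delta>\<close>, strictly less than
      \<epsilon>.\<close>
    define \<delta> where "\<delta> = \<epsilon> / 5"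
    have \<delta>: "\<delta> > 0" using \<epsilon> by (simp add: \<delta>_def)
    obtain \<eta> where \<eta>: "\<eta> > 0" and near:
      "\<And>F w. scalar_functional scale F \<Longrightarrow> (\<And>z. norm (F z) \<le> norm z) \<Longrightarrow> norm w = 1 \<Longrightarrow>
        norm (F w) = 1 \<Longrightarrow> norm (F y) > 1 - \<eta> \<Longrightarrow>
        \<exists>G. scalar_functional scale G \<and> (\<forall>z. norm (G z) \<le> norm z) \<and> norm (G y) = 1 \<and>
          (\<forall>z. norm (G z - F z) \<le> \<delta> * norm z)"
      using property_Lpp_imp_near_supporting_functional[OF L y \<delta>] by blast
    \<comment> \<open>The bound 1 keeps \<open>y + t *\<^sub>R h\<close> nonzero,
      \<open>\<eta> / 2\<close> makes \<open>F\<close> almost norm \<open>y\<close>, and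
      \<open>\<delta>\<^sup>2\<close> turns the estimate \<open>4 * t\<close> for a squared norm
      into \<open>2 * \<delta>\<close>.\<close>
    define d where "d = min 1 (min (\<eta> / 2) (\<delta>\<^sup>2))"
    have "d > 0" using \<eta> \<delta> by (simp add: d_def)
    moreover have "dist (norm_quotient y t h) (norm_derivative y h) < \<epsilon>"
      if t: "0 < t" "t < d" and h: "norm h \<le> 1" for t h
    proof -
      let ?v = "y + t *\<^sub>R h"
      have th: "norm (t *\<^sub>R h) \<le> t" using t h by (simp add: mult_left_le)
      have td: "t < 1" "2 * t < \<eta>" "t < \<delta>\<^sup>2" using t by (auto simp: d_def)
      have v_ge: "norm ?v \<ge> 1 - t"
        using norm_triangle_ineq4[of ?v "t *\<^sub>R h"] th y by simp
      obtain u where u: "linear u" "\<And>z. u z \<le> norm z" "u ?v = norm ?v"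
        using norming_functional[of ?v] by blast
      obtain F where F: "scalar_functional scale F" and reF: "\<And>z. re (F z) = u z"
        using re_lift[OF u(1)] by blast
      have F_le: "norm (F z) \<le> norm z" for z
        using norm_functional_le[OF F, of 1 z] reF u(2) by simp
      have Fv: "norm (F ?v) = norm ?v"
        using F_le[of ?v] re_le_norm[of "F ?v"] reF[of ?v] u(3) by simp
      have v: "norm ?v > 0" using v_ge td(1) by linarith
      have w: "norm (sgn ?v) = 1" "norm (F (sgn ?v)) = 1"
        using v Fv by (auto simp: norm_sgn sgn_div_norm linear_scale[OF scalar_functional_linear[OF F]])
      have uv: "norm ?v = u y + t * u h"
        using u(3) by (simp add: linear_add[OF u(1)] linear_scale[OF u(1)])
      have "u h \<le> 1" "u y \<le> 1" using u(2)[of h] u(2)[of y] h y by auto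
      then have "t * u h \<le> t" using t by (simp add: mult_left_le)
      then have uy: "u y \<ge> 1 - 2 * t"
        using uv v_ge by linarith
      then have "norm (F y) > 1 - \<eta>"
        using re_le_norm[of "F y"] reF[of y] td by simp
      then obtain G where G: "scalar_functional scale G" "\<And>z. norm (G z) \<le> norm z" "norm (G y) = 1"
          "\<And>z. norm (G z - F z) \<le> \<delta> * norm z"
        using near[OF F F_le w] by blast
      let ?c = "G y"
      have c: "?c \<noteq> 0" using G(3) by auto
      \<comment> \<open>A real part of at least \<open>1 - 2 * t\<close> and a modulus of at most 1
        force \<open>F y\<close> itself to be close to 1.\<close>
      have "(norm (1 - F y))\<^sup>2 \<le> 4 * t"
        using norm_one_minus[of "F y"] reF[of y] uy F_le[of y] y abs_square_le_1[of "norm (F y)"]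
        by simp
      also have "\<dots> \<le> (2 * \<delta>)\<^sup>2" using td by (simp add: power_mult_distrib)
      finally have "norm (1 - F y) \<le> 2 * \<delta>"
        by (rule power2_le_imp_le) (use \<delta> in simp)
      then have c1: "norm (?c - 1) \<le> 3 * \<delta>"
        using norm_triangle_ineq4[of "?c - F y" "1 - F y"] G(4)[of y] y by simp
      \<comment> \<open>The property only gives \<open>G y\<close> modulus one; dividing by it
        produces value one at \<open>y\<close> and costs at most
        \<open>3 * \<delta>\<close>.\<close>
      define G' where "G' z = inverse ?c * G z" for z
      have "re (G' h) \<le> norm_derivative y h"
      proof (rule re_supporting_le_norm_derivative[OF _ _ _ y])
        show "scalar_functional scale G'"
          unfolding G'_def[abs_def] by (rule scalar_functional_mult[OF G(1)])
        show "norm (G' z) \<le> norm z" for z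
          using G(2,3) by (simp add: G'_def norm_mult norm_inverse)
        show "G' y = 1" using c by (simp add: G'_def)
      qed
      moreover have "u h \<le> re (G' h) + 4 * \<delta>"
      proof -
        have "G h - G' h = inverse ?c * (?c - 1) * G h"
          using c by (simp add: G'_def field_simps)
        then have "norm (G h - G' h) = norm (?c - 1) * norm (G h)"
          using G(3) by (simp add: norm_mult norm_inverse)
        also have "\<dots> \<le> 3 * \<delta> * 1"
          using c1 G(2)[of h] h \<delta> by (intro mult_mono) auto
        finally have "norm (G h - G' h) \<le> 3 * \<delta>" by simp
        moreover have "norm (G h - F h) \<le> \<delta>"
          using G(4)[of h] mult_left_mono[OF h less_imp_le[OF \<delta>]] by linarith
        ultimately have "norm (F h - G' h) \<le> 4 * \<delta>"
          using norm_triangle_ineq4[of "G h - G' h" "G h - F h"] by simp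
        then show ?thesis
          using re_le_norm[of "F h - G' h"] reF[of h] by (simp add: linear_diff[OF linear_re])
      qed
      \<comment> \<open>This follows from \<open>uv\<close>, since \<open>u y\<close> is at most
        \<open>norm y\<close>.\<close>
      moreover have "norm_quotient y t h \<le> u h"
        using t uv y \<open>u y \<le> 1\<close> by (simp add: norm_quotient_def field_simps)
      ultimately show ?thesis
        using norm_derivative_le_quotient[OF t(1), of y h] \<delta> by (simp add: dist_real_def \<delta>_def)
    qed
    ultimately show "\<forall>\<^sub>F t in at_right 0. \<forall>h\<in>cball 0 1.
        dist (norm_quotient y t h) (norm_derivative y h) < \<epsilon>"
      by (auto simp: eventually_at_right_field)
  qed
  then show "uniform_limit (cball 0 1) (\<lambda>t h. (norm (y + t *\<^sub>R h) - norm y) / t)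
      (norm_derivative y) (at_right 0)"
    by (simp add: norm_quotient_def[abs_def])
qed

lemma property_Lpp_iff_SSD:
  "property_Lpp (scale_ell1 :: 'k \<Rightarrow> ('k, 'n::finite) ell1 \<Rightarrow> _) scale \<longleftrightarrow> SSD_norm TYPE('v)"
  using SSD_imp_property_Lpp property_Lpp_imp_SSD by blast

end

section \<open>Real and complex scalars as instances\<close>

lemma scalar_real_part_real:
  "scalar_real_part (scaleR :: real \<Rightarrow> 'v::real_normed_vector \<Rightarrow> 'v) id"
proof -
  interpret normed_space_over "scaleR :: real \<Rightarrow> 'v \<Rightarrow> 'v"
    by (rule normed_space_over_scaleR)
  show ?thesis
  proof
    show "(norm (1 - c))\<^sup>2 = 1 - 2 * id c + (norm c)\<^sup>2" for c :: real
      by (simp add: power2_eq_square algebra_simps)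
    show "\<exists>F. scalar_functional scaleR F \<and> (\<forall>z. id (F z) = u z)" if "linear u" for u :: "'v \<Rightarrow> real"
      using that by (intro exI[of _ u]) (simp add: scalar_functional_def linear_add linear_scale)
  qed (simp_all add: linear_id[unfolded id_def])
qed

lemma scalar_real_part_complex:
  assumes "normed_space_over (scaleC :: complex \<Rightarrow> 'v::real_normed_vector \<Rightarrow> 'v)"
  shows "scalar_real_part scaleC Re"
proof -
  interpret normed_space_over scaleC by (rule assms)
  show ?thesis
  proof
    show "(norm (1 - c))\<^sup>2 = 1 - 2 * Re c + (norm c)\<^sup>2" for c
      unfolding cmod_power2 by (simp add: power2_eq_square algebra_simps)
    fix u :: "'v \<Rightarrow> real" assume u: "linear u"
    \<comment> \<open>Complex linearity forces this imaginary part, because the imaginary part of a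
      number is minus the real part of its product with \<open>\<i>\<close>.\<close>
    define F where "F z = Complex (u z) (- u (scaleC \<i> z))" for z
    have "F (scaleC c z) = c * F z" for c z
    proof -
      have "scaleC (of_real (Re c) + of_real (Im c) * \<i>) z = Re c *\<^sub>R z + Im c *\<^sub>R scaleC \<i> z"
        by (simp only: scale_left_distrib scale_scale[symmetric] scale_of_real)
      moreover have "of_real (Re c) + of_real (Im c) * \<i> = c" by (simp add: complex_eq_iff)
      ultimately have cz: "scaleC c z = Re c *\<^sub>R z + Im c *\<^sub>R scaleC \<i> z" by simp
      have icz: "scaleC \<i> (scaleC c z) = Re c *\<^sub>R scaleC \<i> z - Im c *\<^sub>R z"
      proof -
        have "scaleC (of_real (Re c) * \<i> + of_real (- Im c)) z = Re c *\<^sub>R scaleC \<i> z + (- Im c) *\<^sub>R z"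
          by (simp only: scale_left_distrib scale_scale[symmetric] scale_of_real)
        moreover have "of_real (Re c) * \<i> + of_real (- Im c) = \<i> * c" by (simp add: complex_eq_iff)
        ultimately show ?thesis by simp
      qed
      show ?thesis
        unfolding F_def icz unfolding cz
        by (simp add: complex_eq_iff linear_add[OF u] linear_diff[OF u] linear_scale[OF u])
    qed
    moreover have "F (z + w) = F z + F w" for z w
      by (simp add: F_def scale_right_distrib linear_add[OF u] complex_eq_iff)
    ultimately have "scalar_functional scaleC F"
      by (simp add: scalar_functional_def)
    moreover have "Re (F z) = u z" for z by (simp add: F_def)
    ultimately show "\<exists>F. scalar_functional scaleC F \<and> (\<forall>z. Re (F z) = u z)"
      by blast
  qed (simp_all)
qed

theorem theorem3p3:
  "(property_Lpp (scale_ell1 :: real \<Rightarrow> (real, 'n::finite) ell1 \<Rightarrow> (real, 'n) ell1)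
      (scaleR :: real \<Rightarrow> 'y::banach \<Rightarrow> 'y) \<longleftrightarrow> SSD_norm TYPE('y)) \<and>
   (\<forall>scaleC :: complex \<Rightarrow> 'z::banach \<Rightarrow> 'z. normed_space_over scaleC \<longrightarrow>
      (property_Lpp (scale_ell1 :: complex \<Rightarrow> (complex, 'n) ell1 \<Rightarrow> (complex, 'n) ell1) scaleC
         \<longleftrightarrow> SSD_norm TYPE('z)))"
  using scalar_real_part.property_Lpp_iff_SSD[OF scalar_real_part_real]
    scalar_real_part.property_Lpp_iff_SSD[OF scalar_real_part_complex] by blast

end
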